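(* Let $0<q<1$, $0<\alpha<q^{-1}$ and $\beta<q^{-1}$ ($\alpha,\beta$ real). Consider the little $q$-Jacobi polynomials $$p_n(x;\alpha,\beta;q)={}_2\varphi_1\left(q^{-n},\alpha\beta q^{n+1};\alpha q;q,qx\right),\qquad n\in\mathbb{N},$$ and the inner product $$\langle f,g\rangle=\sum_{k=0}^\infty f(q^k)\overline{g(q^k)}\,(\alpha q)^k\frac{(\beta q;q)_k}{(q;q)_k}.$$ Then for all $m,n\in\mathbb{N}$ $$\langle p_n(\cdot;\alpha,\beta;q),p_m(\cdot;\alpha,\beta;q)\rangle=\delta_{m,n}\,h_n(\alpha,\beta;q),$$ $$h_n(\alpha,\beta;q)=(\alpha q)^n\,\frac{(q,\beta q;q)_n}{(\alpha q,\alpha\beta q;q)_n}\;\frac{1-\alpha\beta q}{1-\alpha\beta q^{2n+1}}\;\frac{(\alpha\beta q^2;q)_\infty}{(\alpha q;q)_\infty}.$$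
   Context: $\mathbb{N}=\{0,1,2,\dots\}$. $(x;q)_n=\prod_{k=0}^{n-1}(1-xq^k)$, $(x;q)_\infty=\prod_{k\ge0}(1-xq^k)$, $(x_1,\dots,x_m;q)_n=\prod_j(x_j;q)_n$, and ${}_2\varphi_1(a,b;c;q,z)=\sum_{k\ge0}\frac{(a;q)_k(b;q)_k}{(q;q)_k(c;q)_k}z^k$ (a terminating sum when $a=q^{-n}$). If $\alpha\beta q=1$, the expression for $h_n$ is read by continuity, i.e. the factor $1-\alpha\beta q$ is cancelled: $(1-\alpha\beta q)/(\alpha\beta q;q)_n=1/(\alpha\beta q^2;q)_{n-1}$ for $n\ge1$, and for $n=0$ the quotient $(1-\alpha\beta q)/(1-\alpha\beta q^{2n+1})$ equals $1$. *)

theory Defs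
  imports "HOL-Analysis.Analysis"
begin

definition qpoch :: "'a::field \<Rightarrow> 'a \<Rightarrow> nat \<Rightarrow> 'a" where
  "qpoch x q n = (\<Prod>k<n. 1 - x * q ^ k)"

definition qpoch_inf :: "'a::real_normed_field \<Rightarrow> 'a \<Rightarrow> 'a" where
  "qpoch_inf x q = (\<Prod>k. 1 - x * q ^ k)"

definition phi21 :: "'a::real_normed_field \<Rightarrow> 'a \<Rightarrow> 'a \<Rightarrow> 'a \<Rightarrow> 'a \<Rightarrow> 'a" where
  "phi21 a b c q z =
     (\<Sum>k. qpoch a q k * qpoch b q k / (qpoch q q k * qpoch c q k) * z ^ k)"

text \<open>The parameters are real, but the polynomials are functions of a complex variable. The
  series terminates, since its first parameter is \<open>q\<close> to the power \<open>-n\<close>.\<close>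

definition little_q_jacobi :: "nat \<Rightarrow> real \<Rightarrow> real \<Rightarrow> real \<Rightarrow> complex \<Rightarrow> complex" where
  "little_q_jacobi n \<alpha> \<beta> q x =
     phi21 (of_real (q powi (- int n))) (of_real (\<alpha> * \<beta> * q ^ (n + 1)))
       (of_real (\<alpha> * q)) (of_real q) (of_real q * x)"

definition little_q_jacobi_term ::
  "real \<Rightarrow> real \<Rightarrow> real \<Rightarrow> (complex \<Rightarrow> complex) \<Rightarrow> (complex \<Rightarrow> complex) \<Rightarrow> nat \<Rightarrow> complex" where
  "little_q_jacobi_term \<alpha> \<beta> q f g k =
     f (of_real (q ^ k)) * cnj (g (of_real (q ^ k))) *
       of_real ((\<alpha> * q) ^ k * (qpoch (\<beta> * q) q k / qpoch q q k))"

definition little_q_jacobi_inner ::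
  "real \<Rightarrow> real \<Rightarrow> real \<Rightarrow> (complex \<Rightarrow> complex) \<Rightarrow> (complex \<Rightarrow> complex) \<Rightarrow> complex" where
  "little_q_jacobi_inner \<alpha> \<beta> q f g = (\<Sum>k. little_q_jacobi_term \<alpha> \<beta> q f g k)"

text \<open>The squared norm. If \<open>\<alpha> * \<beta> * q = 1\<close>, the formula is read by continuity, that is, with the
  factor \<open>1 - \<alpha> * \<beta> * q\<close> cancelled: for \<open>n \<ge> 1\<close> against the first factor of
  \<open>qpoch (\<alpha> * \<beta> * q) q n\<close>, and for \<open>n = 0\<close> against the denominator
  \<open>1 - \<alpha> * \<beta> * q ^ (2 * n + 1)\<close>.\<close>

definition little_q_jacobi_norm :: "nat \<Rightarrow> real \<Rightarrow> real \<Rightarrow> real \<Rightarrow> real" where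
  "little_q_jacobi_norm n \<alpha> \<beta> q =
     (if \<alpha> * \<beta> * q \<noteq> 1 then
        (\<alpha> * q) ^ n *
        ((qpoch q q n * qpoch (\<beta> * q) q n) / (qpoch (\<alpha> * q) q n * qpoch (\<alpha> * \<beta> * q) q n)) *
        ((1 - \<alpha> * \<beta> * q) / (1 - \<alpha> * \<beta> * q ^ (2 * n + 1))) *
        (qpoch_inf (\<alpha> * \<beta> * q ^ 2) q / qpoch_inf (\<alpha> * q) q)
      else if n = 0 then
        qpoch_inf (\<alpha> * \<beta> * q ^ 2) q / qpoch_inf (\<alpha> * q) q
      else
        (\<alpha> * q) ^ n *
        ((qpoch q q n * qpoch (\<beta> * q) q n) /
          (qpoch (\<alpha> * q) q n * qpoch (\<alpha> * \<beta> * q ^ 2) q (n - 1))) *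
        (1 / (1 - \<alpha> * \<beta> * q ^ (2 * n + 1))) *
        (qpoch_inf (\<alpha> * \<beta> * q ^ 2) q / qpoch_inf (\<alpha> * q) q))"

end

theory Submission
  imports Defs
begin

text \<open>Put \<open>a = \<alpha> q\<close> and \<open>b = \<beta> q\<close>, so that \<open>0 < a < 1\<close> and \<open>b < 1\<close>. The proof pairs \<open>p\<^sub>n\<close> with
  the monomials \<open>x\<^sup>i\<close>, \<open>i \<le> n\<close>: the pairing has to vanish for \<open>i < n\<close>, and its value at \<open>i = n\<close>, times
  the leading coefficient of \<open>p\<^sub>n\<close>, is the squared norm.

  By the q-binomial theorem the moments of the weight are quotients of infinite products
  (\<open>jacobi_moment_sums\<close>), so the pairing of \<open>p\<^sub>n\<close> with \<open>x\<^sup>i\<close> is a finite sum over the coefficients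
  of \<open>p\<^sub>n\<close>. The factor \<open>(q\<^sup>-\<^sup>n;q)\<^sub>j q\<^sup>j / (q;q)\<^sub>j\<close> contained in these coefficients is, up to
  normalization, the weight of the node \<open>q\<^sup>j\<close> in the \<open>n\<close>-th divided difference at
  \<open>1, q, \<dots>, q\<^sup>n\<close>. The pairing is therefore, up to a known factor, the divided difference of a
  function of \<open>y = q\<^sup>j\<close> that collects all other factors (\<open>jacobi_pairing_qdiff\<close>).

  For \<open>i < n\<close> these factors cancel to a polynomial in \<open>y\<close> of degree at most \<open>n - 1\<close>, which the \<open>n\<close>-th
  divided difference annihilates; this is the orthogonality. For \<open>i = n\<close> one factor stays in the
  denominator: the function is \<open>(a y;q)\<^sub>n / (1 - c y)\<close> with \<open>c = a b q\<^sup>n\<^sup>-\<^sup>1\<close>, up to a constant, and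
  \<open>qdiff_prod_over_linear\<close> gives its divided difference as a product. This evaluation takes the
  place of the q-Saalschuetz sum. It involves no division by \<open>\<beta>\<close>, so that \<open>\<beta> = 0\<close> is covered without
  a case distinction. The denominator \<open>1 - c\<close> can vanish for \<open>n = 0\<close> only, where \<open>c = \<alpha> \<beta> q\<close>; that case
  is treated apart and is the q-binomial theorem itself.\<close>

section \<open>Shifted factorials\<close>

lemma qpoch_0 [simp]: "qpoch x q 0 = 1"
  by (simp add: qpoch_def)

lemma qpoch_Suc: "qpoch x q (Suc n) = qpoch x q n * (1 - x * q ^ n)"
  by (simp add: qpoch_def)

lemma qpoch_add: "qpoch x q (m + n) = qpoch x q m * qpoch (x * q ^ m) q n"
  by (induction n) (simp_all add: qpoch_Suc power_add mult_ac)

lemma qpoch_Suc_shift: "qpoch x q (Suc n) = (1 - x) * qpoch (x * q) q n"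
  using qpoch_add[of x q 1 n] by (simp add: qpoch_Suc)

lemma qpoch_pos:
  fixes x q :: real
  assumes "0 < q" "q < 1" "x < 1"
  shows "qpoch x q n > 0"
  unfolding qpoch_def
proof (rule prod_pos)
  fix k
  have "x * q ^ k < 1"
  proof (cases "x \<le> 0")
    case True
    then have "x * q ^ k \<le> 0" using assms by (simp add: mult_nonpos_nonneg)
    then show ?thesis by simp
  next
    case False
    have "x * q ^ k \<le> x * 1"
      using False assms by (intro mult_left_mono) (auto intro: power_le_one)
    then show ?thesis using assms by simp
  qed
  then show "0 < 1 - x * q ^ k" by simp
qed

text \<open>Both sides are \<open>(x;q)\<^sub>i\<^sub>+\<^sub>j\<close>. The identity turns the dependence on \<open>j\<close> through the length of a
  shifted factorial into a dependence on \<open>q\<^sup>j\<close> through its base, with a length that is independent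
  of \<open>j\<close>.\<close>

lemma qpoch_swap:
  fixes x q :: real
  shows "qpoch (x * q ^ i) q j * qpoch x q i = qpoch (x * q ^ j) q i * qpoch x q j"
  using qpoch_add[of x q i j] qpoch_add[of x q j i] by (simp add: add.commute mult.commute)

lemma convergent_prod_qpoch:
  fixes x q :: real
  assumes "0 < q" "q < 1"
  shows "convergent_prod (\<lambda>k. 1 - x * q ^ k)"
proof -
  have "summable (\<lambda>k. \<bar>x\<bar> * q ^ k)"
    using assms by (intro summable_mult summable_geometric) simp
  then have "abs_convergent_prod (\<lambda>k. 1 - x * q ^ k)"
    unfolding abs_convergent_prod_conv_summable using assms by (simp add: abs_mult)
  then show ?thesis by (rule abs_convergent_prod_imp_convergent_prod)
qed

lemma qpoch_LIMSEQ:
  fixes x q :: real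
  assumes "0 < q" "q < 1"
  shows "qpoch x q \<longlonglongrightarrow> qpoch_inf x q"
proof -
  have "(\<lambda>n. qpoch x q (Suc n)) \<longlonglongrightarrow> qpoch_inf x q"
    using convergent_prod_LIMSEQ[OF convergent_prod_qpoch[OF assms, of x]]
    by (simp add: qpoch_def qpoch_inf_def lessThan_Suc_atMost)
  then show ?thesis by (rule LIMSEQ_imp_Suc)
qed

lemma qpoch_inf_shift:
  fixes x q :: real
  assumes "0 < q" "q < 1"
  shows "qpoch_inf x q = qpoch x q n * qpoch_inf (x * q ^ n) q"
proof -
  have "(\<lambda>m. qpoch x q (m + n)) \<longlonglongrightarrow> qpoch_inf x q"
    using qpoch_LIMSEQ[OF assms] by (rule LIMSEQ_ignore_initial_segment)
  moreover have "(\<lambda>m. qpoch x q (m + n)) \<longlonglongrightarrow> qpoch x q n * qpoch_inf (x * q ^ n) q"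
    unfolding add.commute[of _ n] qpoch_add
    by (intro tendsto_mult tendsto_const qpoch_LIMSEQ assms)
  ultimately show ?thesis by (rule LIMSEQ_unique)
qed

lemma qpoch_inf_nonzero:
  fixes x q :: real
  assumes "0 < q" "q < 1" "x < 1"
  shows "qpoch_inf x q \<noteq> 0"
  unfolding qpoch_inf_def
proof (rule prodinf_nonzero[OF convergent_prod_qpoch[OF assms(1,2)]])
  fix k
  show "1 - x * q ^ k \<noteq> 0"
    using qpoch_pos[OF assms, of k] qpoch_pos[OF assms, of "Suc k"] by (auto simp: qpoch_Suc)
qed

section \<open>The q-binomial theorem\<close>

lemma q_binomial_summable:
  fixes b q z :: real
  assumes "0 < q" "q < 1" "\<bar>z\<bar> < 1"
  shows "summable (\<lambda>k. qpoch b q k / qpoch q q k * z ^ k)"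
proof -
  have "(\<lambda>k. qpoch b q k / qpoch q q k) \<longlonglongrightarrow> qpoch_inf b q / qpoch_inf q q"
    using assms by (intro tendsto_divide qpoch_LIMSEQ qpoch_inf_nonzero)
  then have "Bseq (\<lambda>k. qpoch b q k / qpoch q q k)"
    by (intro convergent_imp_Bseq convergentI)
  then obtain K where K: "\<And>k. norm (qpoch b q k / qpoch q q k) \<le> K"
    by (auto simp: Bseq_def)
  show ?thesis
  proof (rule summable_comparison_test')
    show "summable (\<lambda>k. K * \<bar>z\<bar> ^ k)"
      using assms by (intro summable_mult summable_geometric) simp
    show "norm (qpoch b q k / qpoch q q k * z ^ k) \<le> K * \<bar>z\<bar> ^ k" for k
      unfolding norm_mult norm_power real_norm_def[of z]
      by (intro mult_right_mono K) simp
  qed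
qed

text \<open>The functional equation \<open>(1 - z) f(z) = (1 - b z) f(q z)\<close>, which follows from the ratio of
  consecutive coefficients, is iterated: it moves the argument to \<open>0\<close>, where the series is \<open>1\<close>, and
  leaves the quotient of the products behind.\<close>

lemma q_binomial_theorem:
  fixes b q z :: real
  assumes q: "0 < q" "q < 1" and z: "\<bar>z\<bar> < 1"
  shows "(\<lambda>k. qpoch b q k / qpoch q q k * z ^ k) sums (qpoch_inf (b * z) q / qpoch_inf z q)"
proof -
  define c where "c k = qpoch b q k / qpoch q q k" for k
  define f where "f x = (\<Sum>k. c k * x ^ k)" for x
  have summ: "summable (\<lambda>k. c k * x ^ k)" if "\<bar>x\<bar> < 1" for x
    unfolding c_def using q_binomial_summable[OF q that] .
  have qq: "qpoch q q k > 0" for k using q qpoch_pos by blast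
  have crec: "c (Suc k) * (1 - q * q ^ k) = c k * (1 - b * q ^ k)" for k
  proof -
    have "1 - q * q ^ k \<noteq> 0" using qq[of "Suc k"] by (auto simp: qpoch_Suc)
    then show ?thesis using qq[of k] by (simp add: c_def qpoch_Suc field_simps)
  qed
  have fe: "f x * (1 - x) = (1 - b * x) * f (q * x)" if x: "\<bar>x\<bar> < 1" for x
  proof -
    have "q * \<bar>x\<bar> \<le> 1 * \<bar>x\<bar>" using q by (intro mult_right_mono) auto
    then have qx: "\<bar>q * x\<bar> < 1" using x q by (simp add: abs_mult)
    have sh: "f y = 1 + (\<Sum>k. c (Suc k) * y ^ Suc k)" if "\<bar>y\<bar> < 1" for y
      unfolding f_def using suminf_split_head[OF summ[OF that]] by (simp add: c_def)
    have s1: "(\<lambda>k. c (Suc k) * y ^ Suc k) sums (f y - 1)" if "\<bar>y\<bar> < 1" for y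
      using sh[OF that] summable_ignore_initial_segment[OF summ[OF that], of 1]
      by (simp add: sums_iff)
    have s2: "(\<lambda>k. c k * y ^ k) sums f y" if "\<bar>y\<bar> < 1" for y
      unfolding f_def using summ[OF that] by (rule summable_sums)
    have "(\<lambda>k. c (Suc k) * x ^ Suc k - c (Suc k) * (q * x) ^ Suc k - x * (c k * x ^ k)
              + b * x * (c k * (q * x) ^ k))
          sums ((f x - 1) - (f (q * x) - 1) - x * f x + b * x * f (q * x))"
      by (intro sums_add sums_diff sums_mult s1 s2 x qx)
    moreover have "c (Suc k) * x ^ Suc k - c (Suc k) * (q * x) ^ Suc k - x * (c k * x ^ k)
              + b * x * (c k * (q * x) ^ k) = 0" for k
    proof -
      have "c (Suc k) * x ^ Suc k - c (Suc k) * (q * x) ^ Suc k - x * (c k * x ^ k)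
              + b * x * (c k * (q * x) ^ k)
          = x ^ Suc k * (c (Suc k) * (1 - q * q ^ k) - c k * (1 - b * q ^ k))"
        by (simp add: algebra_simps power_mult_distrib)
      then show ?thesis by (simp add: crec)
    qed
    ultimately have "(f x - 1) - (f (q * x) - 1) - x * f x + b * x * f (q * x) = 0"
      by (simp add: sums_iff)
    then show ?thesis by (simp add: algebra_simps)
  qed
  have zq: "\<bar>z * q ^ N\<bar> < 1" for N
  proof -
    have "\<bar>z\<bar> * q ^ N \<le> \<bar>z\<bar> * 1" using q by (intro mult_left_mono power_le_one) auto
    then show ?thesis using z q by (simp add: abs_mult)
  qed
  have iter: "f z * qpoch z q N = qpoch (b * z) q N * f (z * q ^ N)" for N
  proof (induction N)
    case (Suc N)
    have "f z * qpoch z q (Suc N) = qpoch (b * z) q N * (f (z * q ^ N) * (1 - z * q ^ N))"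
      using Suc by (simp add: qpoch_Suc)
    also have "\<dots> = qpoch (b * z) q N * ((1 - b * (z * q ^ N)) * f (q * (z * q ^ N)))"
      by (simp only: fe[OF zq])
    finally show ?case by (simp add: qpoch_Suc mult_ac)
  qed simp
  have "isCont f 0"
    unfolding f_def by (rule isCont_powser[of _ "1/2"]) (use summ[of "1/2"] in auto)
  moreover have "(\<lambda>N. z * q ^ N) \<longlonglongrightarrow> 0"
    using q by (intro tendsto_mult_right_zero LIMSEQ_power_zero) simp
  ultimately have "(\<lambda>N. f (z * q ^ N)) \<longlonglongrightarrow> f 0"
    by (rule isCont_tendsto_compose)
  moreover have "f 0 = 1" unfolding f_def powser_zero by (simp add: c_def)
  ultimately have "(\<lambda>N. qpoch (b * z) q N * f (z * q ^ N)) \<longlonglongrightarrow> qpoch_inf (b * z) q * 1"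
    by (intro tendsto_mult qpoch_LIMSEQ q) simp
  moreover have "(\<lambda>N. f z * qpoch z q N) \<longlonglongrightarrow> f z * qpoch_inf z q"
    by (intro tendsto_mult tendsto_const qpoch_LIMSEQ q)
  ultimately have "f z * qpoch_inf z q = qpoch_inf (b * z) q"
    unfolding iter using LIMSEQ_unique by fastforce
  moreover have "qpoch_inf z q \<noteq> 0" using q z by (intro qpoch_inf_nonzero) auto
  ultimately have "f z = qpoch_inf (b * z) q / qpoch_inf z q" by (simp add: field_simps)
  then show ?thesis
    using summable_sums[OF summ[OF z]] unfolding f_def c_def by simp
qed

section \<open>Divided differences at powers of q\<close>

text \<open>This is \<open>(q;q)\<^sub>n\<close> times the divided difference of \<open>f\<close> at the nodes \<open>1, q, \<dots>, q\<^sup>n\<close>. The weights are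
  written as they occur in a terminating basic hypergeometric series.\<close>

definition qdiff :: "real \<Rightarrow> nat \<Rightarrow> (real \<Rightarrow> real) \<Rightarrow> real" where
  "qdiff q n f = (\<Sum>j\<le>n. qpoch (inverse (q ^ n)) q j / qpoch q q j * q ^ j * f (q ^ j))"

lemma qdiff_add: "qdiff q n (\<lambda>y. f y + g y) = qdiff q n f + qdiff q n g"
  by (simp add: qdiff_def distrib_left sum.distrib)

lemma qdiff_cmult: "qdiff q n (\<lambda>y. c * f y) = c * qdiff q n f"
  by (simp add: qdiff_def sum_distrib_left mult_ac)

lemma qdiff_sum: "qdiff q n (\<lambda>y. \<Sum>i\<in>I. f i y) = (\<Sum>i\<in>I. qdiff q n (f i))"
  unfolding qdiff_def sum_distrib_left by (rule sum.swap)

lemma qdiff_cong: "(\<And>j. j \<le> n \<Longrightarrow> f (q ^ j) = g (q ^ j)) \<Longrightarrow> qdiff q n f = qdiff q n g"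
  unfolding qdiff_def by (intro sum.cong) auto

text \<open>The partial sums of the weights have a closed form for every \<open>x\<close>. For \<open>x = q\<^sup>-\<^sup>n\<close> and all \<open>n + 1\<close>
  terms it contains the factor \<open>1 - q\<^sup>-\<^sup>n\<^sup>+\<^sup>1 q\<^sup>n\<^sup>-\<^sup>1 = 0\<close>, so that constants are annihilated.\<close>

lemma qpoch_sum_telescope:
  fixes x q :: real
  assumes "0 < q" "q < 1"
  shows "(\<Sum>j\<le>J. qpoch x q j / qpoch q q j * q ^ j) = qpoch (x * q) q J / qpoch q q J"
proof (induction J)
  case (Suc J)
  have p: "qpoch q q J > 0" "qpoch q q (Suc J) > 0" using assms qpoch_pos by blast+
  then have nz: "1 - q * q ^ J \<noteq> 0" by (auto simp: qpoch_Suc)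
  have "(\<Sum>j\<le>Suc J. qpoch x q j / qpoch q q j * q ^ j)
      = qpoch (x * q) q J / qpoch q q J + qpoch x q (Suc J) / qpoch q q (Suc J) * q ^ Suc J"
    using Suc by simp
  also have "\<dots> = qpoch (x * q) q J * ((1 - q * q ^ J) + (1 - x) * q ^ Suc J) / qpoch q q (Suc J)"
    unfolding qpoch_Suc_shift[of x] using p nz by (simp add: qpoch_Suc field_simps)
  also have "(1 - q * q ^ J) + (1 - x) * q ^ Suc J = 1 - x * q * q ^ J"
    by (simp add: algebra_simps)
  finally show ?case by (simp add: qpoch_Suc)
qed simp

lemma qdiff_one:
  assumes "0 < q" "q < 1" "0 < n"
  shows "qdiff q n (\<lambda>y. 1) = 0"
proof -
  obtain m where m: "n = Suc m" using assms by (cases n) auto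
  have "qpoch (inverse (q ^ n) * q) q n = 0"
    unfolding m qpoch_Suc using assms by (simp add: field_simps)
  then show ?thesis
    using qpoch_sum_telescope[OF assms(1,2), of "inverse (q ^ n)" n]
    by (simp add: qdiff_def)
qed

text \<open>The factor \<open>y - 1\<close> vanishes at the first node and cancels the last factor of \<open>(q;q)\<^sub>j\<close> at the
  others, so that the difference of \<open>(y - 1) f(y)\<close> at \<open>1, \<dots>, q\<^sup>n\<^sup>+\<^sup>1\<close> is a multiple of the difference of
  \<open>f\<close> at \<open>q, \<dots>, q\<^sup>n\<^sup>+\<^sup>1\<close>. This is the Leibniz rule for divided differences with one linear factor,
  and the only recursion in \<open>n\<close> that is used below.\<close>

lemma qdiff_mult_id:
  assumes "0 < q" "q < 1"
  shows "qdiff q (Suc n) (\<lambda>y. y * f y) =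
           qdiff q (Suc n) f + (1 - q ^ Suc n) / q ^ n * qdiff q n (\<lambda>y. f (q * y))"
proof -
  let ?x = "inverse (q ^ Suc n)"
  have p: "qpoch q q j > 0" for j using assms qpoch_pos by blast
  have nz: "1 - q * q ^ j \<noteq> 0" for j using p[of "Suc j"] by (auto simp: qpoch_Suc)
  have "qdiff q (Suc n) (\<lambda>y. (y - 1) * f y)
      = (\<Sum>j\<le>n. qpoch ?x q (Suc j) / qpoch q q (Suc j) * q ^ Suc j
                   * ((q ^ Suc j - 1) * f (q ^ Suc j)))"
    unfolding qdiff_def sum.atMost_Suc_shift by simp
  also have "\<dots> = (\<Sum>j\<le>n. (1 - q ^ Suc n) / q ^ n *
                  (qpoch (inverse (q ^ n)) q j / qpoch q q j * q ^ j * f (q * q ^ j)))"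
  proof (rule sum.cong)
    fix j
    have "?x * q = inverse (q ^ n)" using assms by (simp add: field_simps)
    then have 1: "qpoch ?x q (Suc j) = (1 - ?x) * qpoch (inverse (q ^ n)) q j"
      by (simp only: qpoch_Suc_shift)
    have 2: "(1 - ?x) * q = - ((1 - q ^ Suc n) / q ^ n)"
      using assms by (simp add: field_simps)
    have "qpoch ?x q (Suc j) / qpoch q q (Suc j) * q ^ Suc j * ((q ^ Suc j - 1) * f (q ^ Suc j))
       = - (((1 - ?x) * q) * (qpoch (inverse (q ^ n)) q j / qpoch q q j * q ^ j * f (q * q ^ j)))"
      unfolding 1 using p[of j] nz[of j] by (simp add: qpoch_Suc divide_simps) (simp add: algebra_simps)
    then show "qpoch ?x q (Suc j) / qpoch q q (Suc j) * q ^ Suc j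
                 * ((q ^ Suc j - 1) * f (q ^ Suc j))
       = (1 - q ^ Suc n) / q ^ n * (qpoch (inverse (q ^ n)) q j / qpoch q q j * q ^ j * f (q * q ^ j))"
      unfolding 2 by simp
  qed simp
  also have "\<dots> = (1 - q ^ Suc n) / q ^ n * qdiff q n (\<lambda>y. f (q * y))"
    by (simp add: qdiff_def sum_distrib_left)
  finally have "qdiff q (Suc n) (\<lambda>y. (y - 1) * f y)
      = (1 - q ^ Suc n) / q ^ n * qdiff q n (\<lambda>y. f (q * y))" .
  moreover have "qdiff q (Suc n) (\<lambda>y. y * f y)
      = qdiff q (Suc n) (\<lambda>y. f y + (y - 1) * f y)"
    by (rule arg_cong[of _ _ "qdiff q (Suc n)"]) (auto simp: algebra_simps)
  ultimately show ?thesis by (simp add: qdiff_add)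
qed

lemma qdiff_power:
  assumes "0 < q" "q < 1" "d < n"
  shows "qdiff q n (\<lambda>y. y ^ d) = 0"
  using assms(3)
proof (induction d arbitrary: n)
  case 0
  then show ?case using qdiff_one[OF assms(1,2)] by simp
next
  case (Suc d)
  then obtain m where m: "n = Suc m" "d < m" by (cases n) auto
  then show ?case
    using Suc.IH[of n] Suc.IH[of m] Suc.prems qdiff_mult_id[OF assms(1,2), of m "\<lambda>y. y ^ d"]
    by (simp add: power_mult_distrib qdiff_cmult)
qed

lemma qdiff_poly:
  assumes "0 < q" "q < 1" "degree p < n"
  shows "qdiff q n (poly p) = 0"
proof -
  have "qdiff q n (poly p) = qdiff q n (\<lambda>y. \<Sum>i\<le>degree p. coeff p i * y ^ i)"
    unfolding poly_altdef[abs_def] ..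
  also have "\<dots> = 0"
    unfolding qdiff_sum qdiff_cmult using assms by (simp add: qdiff_power)
  finally show ?thesis .
qed

lemma degree_prod_linear_le:
  fixes A :: "nat \<Rightarrow> real"
  shows "degree (\<Prod>k<r. [:1, - A k:]) \<le> r"
proof -
  have "degree (\<Prod>k<r. [:1, - A k:]) \<le> (\<Sum>k<r. 1)"
    by (intro order_trans[OF degree_prod_sum_le] sum_mono) auto
  then show ?thesis by simp
qed

text \<open>The two shapes of polynomials of degree less than \<open>n\<close> that occur: the first in the orthogonality
  relation, the second when linear factors are traded for powers of \<open>y\<close>.\<close>

lemma qdiff_prod_linear:
  fixes A B :: "nat \<Rightarrow> real"
  assumes "0 < q" "q < 1" "r + s < n"
  shows "qdiff q n (\<lambda>y. (\<Prod>k<r. 1 - A k * y) * (\<Prod>k<s. 1 - B k * y)) = 0"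
    and "qdiff q n (\<lambda>y. (\<Prod>k<r. 1 - A k * y) * y ^ s) = 0"
proof -
  have "degree ((\<Prod>k<r. [:1, - A k:]) * (\<Prod>k<s. [:1, - B k:])) < n"
    using degree_mult_le[of "\<Prod>k<r. [:1, - A k:]" "\<Prod>k<s. [:1, - B k:]"]
      degree_prod_linear_le[of A r] degree_prod_linear_le[of B s] assms(3) by linarith
  from qdiff_poly[OF assms(1,2) this]
  show "qdiff q n (\<lambda>y. (\<Prod>k<r. 1 - A k * y) * (\<Prod>k<s. 1 - B k * y)) = 0"
    by (simp add: poly_prod poly_mult[abs_def] mult.commute)
  have "degree ((\<Prod>k<r. [:1, - A k:]) * monom 1 s) < n"
    using degree_mult_le[of "\<Prod>k<r. [:1, - A k:]" "monom 1 s"]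
      degree_prod_linear_le[of A r] degree_monom_le[of "1::real" s] assms(3) by linarith
  from qdiff_poly[OF assms(1,2) this]
  show "qdiff q n (\<lambda>y. (\<Prod>k<r. 1 - A k * y) * y ^ s) = 0"
    by (simp add: poly_prod poly_monom poly_mult[abs_def] mult.commute)
qed

text \<open>The Leibniz rule expresses the difference of \<open>y\<^sup>n\<^sup>+\<^sup>1 / (1 - c y)\<close> by that of
  \<open>y\<^sup>n / (1 - c y)\<close> of the same order and that of \<open>y\<^sup>n / (1 - c q y)\<close> of order \<open>n\<close>. The former is \<open>c\<close>
  times the quantity sought, which leaves a recursion with \<open>c\<close> replaced by \<open>c q\<close>. Starting from the
  power \<open>y\<^sup>n\<close> instead of from \<open>1 / (1 - c y)\<close> avoids a division by \<open>c\<^sup>n\<close>.\<close>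

lemma qdiff_power_over_linear:
  assumes q: "0 < q" "q < 1" and "\<And>k. k \<le> n \<Longrightarrow> c * q ^ k \<noteq> 1"
  shows "qdiff q n (\<lambda>y. y ^ n / (1 - c * y)) = qpoch q q n / qpoch c q (Suc n)"
  using assms(3)
proof (induction n arbitrary: c)
  case 0
  then show ?case by (simp add: qdiff_def qpoch_Suc)
next
  case (Suc n)
  let ?X = "qdiff q (Suc n) (\<lambda>y. y ^ Suc n / (1 - c * y))"
  have c1: "c \<noteq> 1" using Suc.prems[of 0] by simp
  have IH: "qdiff q n (\<lambda>y. y ^ n / (1 - (c * q) * y)) = qpoch q q n / qpoch (c * q) q (Suc n)"
  proof (rule Suc.IH)
    show "c * q * q ^ k \<noteq> 1" if "k \<le> n" for k
      using Suc.prems[of "Suc k"] that by (simp add: mult.assoc)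
  qed
  \<comment> \<open>Since \<open>y ^ n\<close> is annihilated, one power of \<open>y\<close> in the numerator can be traded for a factor \<open>c\<close>.\<close>
  have "qdiff q (Suc n) (\<lambda>y. y ^ n / (1 - c * y))
      = qdiff q (Suc n) (\<lambda>y. y ^ n + c * (y ^ Suc n / (1 - c * y)))"
  proof (rule qdiff_cong)
    fix j assume "j \<le> Suc n"
    then have "1 - c * q ^ j \<noteq> 0" using Suc.prems[of j] by simp
    then show "(q ^ j) ^ n / (1 - c * q ^ j)
        = (q ^ j) ^ n + c * ((q ^ j) ^ Suc n / (1 - c * q ^ j))"
      by (simp add: divide_simps) (simp add: algebra_simps)
  qed
  also have "\<dots> = c * ?X"
    using qdiff_power[OF q, of n "Suc n"] by (simp only: qdiff_add qdiff_cmult)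
  finally have 1: "qdiff q (Suc n) (\<lambda>y. y ^ n / (1 - c * y)) = c * ?X" .
  have "?X = qdiff q (Suc n) (\<lambda>y. y * (y ^ n / (1 - c * y)))" by simp
  also have "\<dots> = c * ?X
      + (1 - q ^ Suc n) / q ^ n * qdiff q n (\<lambda>y. (q * y) ^ n / (1 - c * (q * y)))"
    by (simp only: qdiff_mult_id[OF q] 1)
  also have "qdiff q n (\<lambda>y. (q * y) ^ n / (1 - c * (q * y)))
      = q ^ n * qdiff q n (\<lambda>y. y ^ n / (1 - (c * q) * y))"
    by (simp add: qdiff_cmult[symmetric] power_mult_distrib mult.assoc)
  also have "(1 - q ^ Suc n) / q ^ n * (q ^ n * qdiff q n (\<lambda>y. y ^ n / (1 - (c * q) * y)))
      = (1 - q ^ Suc n) * (qpoch q q n / qpoch (c * q) q (Suc n))"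
    unfolding IH using q by simp
  finally have "(1 - c) * ?X = (1 - q ^ Suc n) * (qpoch q q n / qpoch (c * q) q (Suc n))"
    unfolding left_diff_distrib by linarith
  moreover have "?X = (1 - c) * ?X / (1 - c)" using c1 by simp
  ultimately have "?X = (1 - q ^ Suc n) * (qpoch q q n / qpoch (c * q) q (Suc n)) / (1 - c)"
    by (simp only:)
  then show ?case
    unfolding qpoch_Suc_shift[of c q "Suc n"] by (simp add: qpoch_Suc mult_ac)
qed

text \<open>Writing \<open>1 - A y = (1 - c y) + (c - A) y\<close>, the first summand cancels the denominator and leaves
  a polynomial of degree at most \<open>n - 1\<close>, which is annihilated. Each linear factor can thus be replaced by
  \<open>(c - A) y\<close>, until only \<open>y\<^sup>n / (1 - c y)\<close> is left.\<close>

lemma qdiff_prod_over_linear: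
  fixes A :: "nat \<Rightarrow> real"
  assumes q: "0 < q" "q < 1" and c: "\<And>k. k \<le> n \<Longrightarrow> c * q ^ k \<noteq> 1"
  shows "qdiff q n (\<lambda>y. (\<Prod>k<n. 1 - A k * y) / (1 - c * y)) =
           (\<Prod>k<n. c - A k) * qpoch q q n / qpoch c q (Suc n)"
proof -
  have "qdiff q n (\<lambda>y. (\<Prod>k<r. 1 - A k * y) * y ^ (n - r) / (1 - c * y)) =
           (\<Prod>k<r. c - A k) * qdiff q n (\<lambda>y. y ^ n / (1 - c * y))" if "r \<le> n" for r
    using that
  proof (induction r)
    case (Suc r)
    then obtain s where s: "n = Suc (r + s)" by (auto simp: less_eq_Suc_le[symmetric] less_iff_Suc_add)
    have "qdiff q n (\<lambda>y. (\<Prod>k<Suc r. 1 - A k * y) * y ^ (n - Suc r) / (1 - c * y))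
       = qdiff q n (\<lambda>y. (\<Prod>k<r. 1 - A k * y) * y ^ s
            + (c - A r) * ((\<Prod>k<r. 1 - A k * y) * y ^ (n - r) / (1 - c * y)))"
    proof (rule qdiff_cong)
      fix j assume "j \<le> n"
      then have nz: "1 - c * q ^ j \<noteq> 0" using c[of j] by simp
      have "P * (1 - A r * y) * y ^ s / (1 - c * y)
          = P * y ^ s + (c - A r) * (P * y ^ Suc s / (1 - c * y))" if "1 - c * y \<noteq> 0" for P y
        using that by (simp add: divide_simps) (simp add: algebra_simps)
      from this[OF nz] show "(\<Prod>k<Suc r. 1 - A k * q ^ j) * (q ^ j) ^ (n - Suc r) / (1 - c * q ^ j)
        = (\<Prod>k<r. 1 - A k * q ^ j) * (q ^ j) ^ s
            + (c - A r) * ((\<Prod>k<r. 1 - A k * q ^ j) * (q ^ j) ^ (n - r) / (1 - c * q ^ j))"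
        using s by (simp add: Suc_diff_le)
    qed
    also have "\<dots> = (c - A r) * qdiff q n (\<lambda>y. (\<Prod>k<r. 1 - A k * y) * y ^ (n - r) / (1 - c * y))"
      using qdiff_prod_linear(2)[OF q, of r s n A] s by (simp only: qdiff_add qdiff_cmult)
    finally show ?case using Suc by simp
  qed simp
  from this[of n] show ?thesis
    using qdiff_power_over_linear[OF q c] by simp
qed

section \<open>Pairing the polynomials with monomials\<close>

text \<open>Here and below \<open>a = \<alpha> q\<close> and \<open>b = \<beta> q\<close>, so that \<open>\<alpha> \<beta> q\<^sup>n\<^sup>+\<^sup>1\<close> becomes \<open>a b q\<^sup>n\<^sup>-\<^sup>1\<close>; the latter is
  written with a division by \<open>q\<close> because truncated subtraction would change it for \<open>n = 0\<close>.\<close>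

definition jacobi_coeff :: "real \<Rightarrow> real \<Rightarrow> real \<Rightarrow> nat \<Rightarrow> nat \<Rightarrow> real" where
  "jacobi_coeff a b q n j =
     qpoch (inverse (q ^ n)) q j * qpoch (a * b * q ^ n / q) q j / (qpoch q q j * qpoch a q j) * q ^ j"

definition jacobi_moment :: "real \<Rightarrow> real \<Rightarrow> real \<Rightarrow> nat \<Rightarrow> real" where
  "jacobi_moment a b q s = qpoch_inf (a * b * q ^ s) q / qpoch_inf (a * q ^ s) q"

lemma mult_less_one_of_less_one:
  fixes a b :: real
  assumes "0 < a" "a < 1" "b < 1"
  shows "a * b < 1"
  using mult_strict_left_mono[OF assms(3,1)] assms(2) by simp

lemma mult_power_less_one:
  fixes x q :: real
  assumes "0 < q" "q < 1" "x < 1"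
  shows "x * q ^ k < 1"
  using qpoch_pos[OF assms, of k] qpoch_pos[OF assms, of "Suc k"]
  by (auto simp: qpoch_Suc zero_less_mult_iff)

lemma jacobi_moment_sums:
  assumes "0 < q" "q < 1" "0 < a" "a < 1"
  shows "(\<lambda>k. (q ^ k) ^ s * (a ^ k * (qpoch b q k / qpoch q q k))) sums jacobi_moment a b q s"
proof -
  have "\<bar>a * q ^ s\<bar> < 1" using assms mult_power_less_one[of q a s] by simp
  from q_binomial_theorem[OF assms(1,2) this, of b] show ?thesis
    unfolding jacobi_moment_def
    by (simp add: power_mult_distrib power_mult[symmetric] mult_ac)
qed

lemma jacobi_moment_add:
  assumes "0 < q" "q < 1" "0 < a" "a < 1" "b < 1"
  shows "jacobi_moment a b q (i + j) =
           jacobi_moment a b q i * (qpoch (a * q ^ i) q j / qpoch (a * b * q ^ i) q j)"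
proof -
  have ab: "a * b < 1" using assms by (intro mult_less_one_of_less_one)
  have nz: "qpoch (a * b * q ^ i) q j \<noteq> 0" "qpoch (a * q ^ i) q j \<noteq> 0"
    using assms ab by (simp_all add: qpoch_pos mult_power_less_one less_imp_neq[symmetric])
  have "qpoch_inf (a * b * q ^ i) q = qpoch (a * b * q ^ i) q j * qpoch_inf (a * b * q ^ (i + j)) q"
    and "qpoch_inf (a * q ^ i) q = qpoch (a * q ^ i) q j * qpoch_inf (a * q ^ (i + j)) q"
    using qpoch_inf_shift[OF assms(1,2), of "a * b * q ^ i" j]
      qpoch_inf_shift[OF assms(1,2), of "a * q ^ i" j]
    by (simp_all only: power_add mult.assoc)
  then show ?thesis using nz by (simp add: jacobi_moment_def)
qed

text \<open>The moment of order \<open>i + j\<close> contributes \<open>(a q\<^sup>i;q)\<^sub>j\<close>, which combines with the denominator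
  \<open>(a;q)\<^sub>j\<close> of the coefficient to \<open>(a q\<^sup>j;q)\<^sub>i / (a;q)\<^sub>i\<close>. The remaining quotient has to be exhibited as a
  function \<open>g\<close> of \<open>q\<^sup>j\<close>; its form depends on whether \<open>i < n\<close> or \<open>i = n\<close>.\<close>

lemma jacobi_pairing_qdiff:
  assumes "0 < q" "q < 1" "0 < a" "a < 1" "b < 1"
    and g: "\<And>j. qpoch (a * b * q ^ n / q) q j / qpoch (a * b * q ^ i) q j = g (q ^ j)"
  shows "(\<Sum>j\<le>n. jacobi_coeff a b q n j * jacobi_moment a b q (i + j)) =
           jacobi_moment a b q i / qpoch a q i * qdiff q n (\<lambda>y. qpoch (a * y) q i * g y)"
  unfolding qdiff_def sum_distrib_left
proof (rule sum.cong)
  fix j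
  have pa: "qpoch a q k \<noteq> 0" for k using qpoch_pos[of q a k] assms by simp
  have "qpoch (a * q ^ i) q j / qpoch a q j = qpoch (a * q ^ j) q i / qpoch a q i"
    using qpoch_swap[of a q i j] pa by (simp add: field_simps)
  moreover have "jacobi_coeff a b q n j * jacobi_moment a b q (i + j) =
      jacobi_moment a b q i * (qpoch (inverse (q ^ n)) q j / qpoch q q j * q ^ j)
      * (qpoch (a * q ^ i) q j / qpoch a q j)
      * (qpoch (a * b * q ^ n / q) q j / qpoch (a * b * q ^ i) q j)"
    by (simp add: jacobi_coeff_def jacobi_moment_add[OF assms(1-5)])
  ultimately show "jacobi_coeff a b q n j * jacobi_moment a b q (i + j) =
      jacobi_moment a b q i / qpoch a q i *
      (qpoch (inverse (q ^ n)) q j / qpoch q q j * q ^ j * (qpoch (a * q ^ j) q i * g (q ^ j)))"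
    by (simp add: g[symmetric] mult_ac)
qed simp

text \<open>For \<open>i < n\<close> the quotient \<open>(a b q\<^sup>n\<^sup>-\<^sup>1;q)\<^sub>j / (a b q\<^sup>i;q)\<^sub>j\<close> is a polynomial in \<open>q\<^sup>j\<close> of degree at
  most \<open>n - 1 - i\<close>. Together with \<open>(a q\<^sup>j;q)\<^sub>i\<close> this makes at most \<open>n - 1\<close>.\<close>

lemma jacobi_pairing_lower:
  assumes "0 < q" "q < 1" "0 < a" "a < 1" "b < 1" and "i < n"
  shows "(\<Sum>j\<le>n. jacobi_coeff a b q n j * jacobi_moment a b q (i + j)) = 0"
proof -
  obtain s where s: "n = Suc (i + s)" using \<open>i < n\<close> by (auto simp: less_iff_Suc_add)
  let ?x = "a * b * q ^ i"
  have ab: "a * b < 1" using assms by (intro mult_less_one_of_less_one)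
  have nz: "qpoch ?x q j \<noteq> 0" for j
    using assms ab by (simp add: qpoch_pos mult_power_less_one less_imp_neq[symmetric])
  have x: "a * b * q ^ n / q = ?x * q ^ s" using assms by (simp add: s power_add)
  have g: "qpoch (a * b * q ^ n / q) q j / qpoch ?x q j = qpoch (?x * q ^ j) q s / qpoch ?x q s" for j
    unfolding x using qpoch_swap[of ?x q s j] nz by (simp add: field_simps)
  have "qdiff q n (\<lambda>y. (1 / qpoch ?x q s) *
      ((\<Prod>k<i. 1 - (a * q ^ k) * y) * (\<Prod>k<s. 1 - (?x * q ^ k) * y))) = 0"
    unfolding qdiff_cmult using qdiff_prod_linear(1)[OF assms(1,2), of i s n] s by simp
  then have "qdiff q n (\<lambda>y. qpoch (a * y) q i * (qpoch (?x * y) q s / qpoch ?x q s)) = 0"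
    by (simp add: qpoch_def mult_ac)
  then show ?thesis
    by (simp add: jacobi_pairing_qdiff[where n = n and i = i and g = "\<lambda>y. qpoch (?x * y) q s / qpoch ?x q s", OF assms(1-5) g])
qed

text \<open>For \<open>i = n\<close> the quotient \<open>(c;q)\<^sub>j / (c q;q)\<^sub>j\<close> is \<open>(1 - c) / (1 - c q\<^sup>j)\<close>. For \<open>n > 0\<close> all
  denominators \<open>1 - c q\<^sup>k\<close> are positive, while \<open>c = a b / q\<close> may be \<open>1\<close> for \<open>n = 0\<close>.\<close>

lemma jacobi_pairing_diag:
  assumes "0 < q" "q < 1" "0 < a" "a < 1" "b < 1" and "0 < n"
  defines "c \<equiv> a * b * q ^ n / q"
  shows "(\<Sum>j\<le>n. jacobi_coeff a b q n j * jacobi_moment a b q (n + j)) =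
           jacobi_moment a b q n / qpoch a q n *
           ((1 - c) * ((\<Prod>k<n. c - a * q ^ k) * qpoch q q n / qpoch c q (Suc n)))"
proof -
  obtain m where m: "n = Suc m" using \<open>0 < n\<close> by (cases n) auto
  have ab: "a * b < 1" using assms by (intro mult_less_one_of_less_one)
  have c: "c = a * b * q ^ m" using assms by (simp add: c_def m)
  have c1: "c < 1" unfolding c using assms ab by (intro mult_power_less_one)
  have ck: "c * q ^ k \<noteq> 1" for k using mult_power_less_one[OF assms(1,2) c1, of k] by simp
  have cq: "a * b * q ^ n = c * q" using assms by (simp add: c_def)
  have nz: "qpoch (c * q) q j \<noteq> 0" for j
    using qpoch_pos[of q "c * q" j] mult_power_less_one[OF assms(1,2) c1, of 1] assms(1,2) by simp
  have g: "qpoch (a * b * q ^ n / q) q j / qpoch (a * b * q ^ n) q j = (1 - c) / (1 - c * q ^ j)" for j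
    unfolding cq using qpoch_Suc_shift[of c q j] nz[of j] ck[of j] assms(1)
    by (simp add: qpoch_Suc field_simps)
  have "qdiff q n (\<lambda>y. qpoch (a * y) q n * ((1 - c) / (1 - c * y)))
      = qdiff q n (\<lambda>y. (1 - c) * ((\<Prod>k<n. 1 - (a * q ^ k) * y) / (1 - c * y)))"
    by (simp add: qpoch_def mult_ac)
  also have "\<dots> = (1 - c) * ((\<Prod>k<n. c - a * q ^ k) * qpoch q q n / qpoch c q (Suc n))"
    unfolding qdiff_cmult by (subst qdiff_prod_over_linear[OF assms(1,2) ck]) simp
  finally show ?thesis
    by (simp add: jacobi_pairing_qdiff[where n = n and i = n and g = "\<lambda>y. (1 - c) / (1 - c * y)", OF assms(1-5) g])
qed

text \<open>In both products on the left the \<open>k\<close>-th factor carries a stray power of \<open>q\<close>; after the order of one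
  of them is reversed, these powers and the signs cancel factor by factor.\<close>

lemma qpoch_inverse_prod:
  fixes a b q :: real
  assumes "0 < q"
  shows "qpoch (inverse (q ^ n)) q n * q ^ n * (\<Prod>k<n. a * b * q ^ n / q - a * q ^ k) =
           a ^ n * qpoch b q n * qpoch q q n"
proof -
  have "qpoch (inverse (q ^ n)) q n * q ^ n = (\<Prod>k<n. (1 - inverse (q ^ n) * q ^ k) * q)"
    by (simp add: qpoch_def prod.distrib)
  also have "\<dots> = (\<Prod>k<n. (1 - inverse (q ^ n) * q ^ (n - Suc k)) * q)"
    by (rule prod.nat_diff_reindex[symmetric])
  finally have "qpoch (inverse (q ^ n)) q n * q ^ n * (\<Prod>k<n. a * b * q ^ n / q - a * q ^ k) =
     (\<Prod>k<n. (1 - inverse (q ^ n) * q ^ (n - Suc k)) * q * (a * b * q ^ n / q - a * q ^ k))"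
    by (simp add: prod.distrib)
  also have "\<dots> = (\<Prod>k<n. a * (1 - b * q ^ (n - Suc k)) * (1 - q * q ^ k))"
  proof (rule prod.cong)
    fix k assume "k \<in> {..<n}"
    then obtain d where d: "n = Suc (k + d)" by (auto simp: less_iff_Suc_add)
    show "(1 - inverse (q ^ n) * q ^ (n - Suc k)) * q * (a * b * q ^ n / q - a * q ^ k) =
       a * (1 - b * q ^ (n - Suc k)) * (1 - q * q ^ k)"
      using assms by (simp add: d power_add divide_simps) (simp add: algebra_simps)
  qed simp
  also have "\<dots> = a ^ n * (\<Prod>k<n. 1 - b * q ^ (n - Suc k)) * (\<Prod>k<n. 1 - q * q ^ k)"
    by (simp add: prod.distrib)
  also have "(\<Prod>k<n. 1 - b * q ^ (n - Suc k)) = (\<Prod>k<n. 1 - b * q ^ k)"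
    by (rule prod.nat_diff_reindex)
  finally show ?thesis by (simp add: qpoch_def)
qed

text \<open>For \<open>n > 0\<close> both branches of the definition of the norm agree with the formula \<open>H\<close> below, in
  which \<open>1 - \<alpha> \<beta> q\<close> has been cancelled against the first factor of \<open>(\<alpha> \<beta> q;q)\<^sub>n\<close>.\<close>

lemma jacobi_norm_eq:
  assumes q: "0 < q" "q < 1" and "0 < \<alpha>" "\<alpha> * q < 1" "\<beta> * q < 1"
  defines "a \<equiv> \<alpha> * q" and "b \<equiv> \<beta> * q"
  shows "jacobi_coeff a b q n n * (\<Sum>j\<le>n. jacobi_coeff a b q n j * jacobi_moment a b q (n + j)) =
           little_q_jacobi_norm n \<alpha> \<beta> q"
proof (cases n)
  case 0
  have "\<alpha> * \<beta> * q ^ 2 = a * b" "\<alpha> * q = a" by (simp_all add: a_def b_def power2_eq_square)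
  then show ?thesis
    by (simp add: 0 jacobi_coeff_def jacobi_moment_def little_q_jacobi_norm_def)
next
  case (Suc m)
  have a: "0 < a" "a < 1" "b < 1" using assms by (auto simp: a_def b_def)
  have ab: "a * b < 1" using a by (intro mult_less_one_of_less_one)
  define c where "c = a * b * q ^ n / q"
  have cm: "c = a * b * q ^ m" using q by (simp add: c_def Suc)
  have c1: "c < 1" unfolding cm using q ab by (intro mult_power_less_one)
  have cn: "c * q ^ n < 1" using q c1 by (intro mult_power_less_one)
  have pos: "qpoch a q n > 0" "qpoch q q n > 0" "qpoch c q n > 0" "qpoch (a * b) q m > 0"
    using q a ab c1 by (simp_all add: qpoch_pos)
  have inf: "qpoch_inf (a * q ^ n) q \<noteq> 0"
    using q a by (intro qpoch_inf_nonzero mult_power_less_one)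
  have ia: "qpoch_inf a q = qpoch a q n * qpoch_inf (a * q ^ n) q"
    using q by (rule qpoch_inf_shift)
  have iab: "qpoch_inf (a * b) q = qpoch (a * b) q m * (1 - c) * qpoch_inf (a * b * q ^ n) q"
    using qpoch_inf_shift[OF q, of "a * b" n] by (simp add: Suc qpoch_Suc cm)
  define H where "H = a ^ n * (qpoch q q n * qpoch b q n / (qpoch a q n * qpoch (a * b) q m))
      * (1 / (1 - c * q ^ n)) * (qpoch_inf (a * b) q / qpoch_inf a q)"
  have "jacobi_coeff a b q n n * (\<Sum>j\<le>n. jacobi_coeff a b q n j * jacobi_moment a b q (n + j))
      = (qpoch (inverse (q ^ n)) q n * q ^ n * (\<Prod>k<n. c - a * q ^ k)) *
        (1 - c) / (1 - c * q ^ n) * (jacobi_moment a b q n / (qpoch a q n * qpoch a q n))"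
  proof -
    have "0 < n" by (simp add: Suc)
    show ?thesis
      unfolding jacobi_pairing_diag[OF q a \<open>0 < n\<close>] jacobi_coeff_def[of a b q n n]
        c_def[symmetric] qpoch_Suc[of c q n]
      using pos by (simp add: mult_ac)
  qed
  also have "\<dots> = H"
    unfolding c_def qpoch_inverse_prod[OF q(1)]
    unfolding c_def[symmetric] H_def ia iab jacobi_moment_def
    using pos inf cn by (simp add: mult_ac)
  also have "H = little_q_jacobi_norm n \<alpha> \<beta> q"
  proof -
    have e: "\<alpha> * q = a" "\<beta> * q = b" "\<alpha> * \<beta> * q ^ 2 = a * b" "\<alpha> * \<beta> * q ^ (2 * n + 1) = c * q ^ n"
      using q by (simp_all add: a_def b_def c_def power2_eq_square power_add mult_2)
    show ?thesis
    proof (cases "\<alpha> * \<beta> * q = 1")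
      case True
      then show ?thesis unfolding little_q_jacobi_norm_def e H_def by (simp add: Suc)
    next
      case False
      have "\<alpha> * \<beta> * q * q = a * b" by (simp add: a_def b_def)
      then have "qpoch (\<alpha> * \<beta> * q) q n = (1 - \<alpha> * \<beta> * q) * qpoch (a * b) q m"
        by (simp add: Suc qpoch_Suc_shift)
      then show ?thesis unfolding little_q_jacobi_norm_def e H_def using False by simp
    qed
  qed
  finally show ?thesis .
qed

section \<open>Orthogonality\<close>

definition jacobi_real :: "real \<Rightarrow> real \<Rightarrow> real \<Rightarrow> nat \<Rightarrow> real \<Rightarrow> real" where
  "jacobi_real a b q n x = (\<Sum>j\<le>n. jacobi_coeff a b q n j * x ^ j)"

lemma qpoch_of_real: "qpoch (of_real x) (of_real q) n = (of_real (qpoch x q n) :: complex)"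
  by (simp add: qpoch_def)

lemma qpoch_inverse_eq_0:
  fixes q :: real
  assumes "0 < q" "n < j"
  shows "qpoch (inverse (q ^ n)) q j = 0"
  unfolding qpoch_def using assms by (intro prod_zero) (auto intro!: bexI[of _ n])

lemma little_q_jacobi_of_real:
  assumes "0 < q"
  shows "little_q_jacobi n \<alpha> \<beta> q (of_real x) = of_real (jacobi_real (\<alpha> * q) (\<beta> * q) q n x)"
proof -
  have e: "\<alpha> * \<beta> * q ^ (n + 1) = \<alpha> * q * (\<beta> * q) * q ^ n / q" using assms by simp
  have p: "q powi (- int n) = inverse (q ^ n)" by (simp add: power_int_minus)
  have "little_q_jacobi n \<alpha> \<beta> q (of_real x) =
     (\<Sum>k. of_real (jacobi_coeff (\<alpha> * q) (\<beta> * q) q n k * x ^ k))"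
    unfolding little_q_jacobi_def phi21_def e p qpoch_of_real
    by (simp add: jacobi_coeff_def power_mult_distrib mult_ac)
  also have "\<dots> = (\<Sum>k\<le>n. of_real (jacobi_coeff (\<alpha> * q) (\<beta> * q) q n k * x ^ k))"
    by (rule suminf_finite) (auto simp: jacobi_coeff_def qpoch_inverse_eq_0[OF assms])
  finally show ?thesis by (simp add: jacobi_real_def)
qed

lemma jacobi_real_sums:
  assumes "0 < q" "q < 1" "0 < a" "a < 1"
  shows "(\<lambda>k. jacobi_real a b q n (q ^ k) * jacobi_real a b q m (q ^ k)
              * (a ^ k * (qpoch b q k / qpoch q q k))) sums
     (\<Sum>i\<le>m. jacobi_coeff a b q m i * (\<Sum>j\<le>n. jacobi_coeff a b q n j * jacobi_moment a b q (i + j)))"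
proof -
  let ?w = "\<lambda>k. a ^ k * (qpoch b q k / qpoch q q k)"
  have "(\<lambda>k. \<Sum>i\<le>m. jacobi_coeff a b q m i *
            (\<Sum>j\<le>n. jacobi_coeff a b q n j * ((q ^ k) ^ (i + j) * ?w k))) sums
     (\<Sum>i\<le>m. jacobi_coeff a b q m i * (\<Sum>j\<le>n. jacobi_coeff a b q n j * jacobi_moment a b q (i + j)))"
    by (intro sums_sum sums_mult jacobi_moment_sums assms)
  moreover have "(\<Sum>i\<le>m. jacobi_coeff a b q m i *
            (\<Sum>j\<le>n. jacobi_coeff a b q n j * ((q ^ k) ^ (i + j) * ?w k))) =
     jacobi_real a b q n (q ^ k) * jacobi_real a b q m (q ^ k) * ?w k" for k
  proof -
    have "jacobi_real a b q n (q ^ k) * jacobi_real a b q m (q ^ k) * ?w k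
        = (\<Sum>i\<le>m. jacobi_coeff a b q m i * (q ^ k) ^ i *
            (\<Sum>j\<le>n. jacobi_coeff a b q n j * (q ^ k) ^ j * ?w k))"
      unfolding jacobi_real_def sum_distrib_right[symmetric] by (simp only: mult_ac)
    then show ?thesis by (simp add: sum_distrib_left power_add mult_ac)
  qed
  ultimately show ?thesis by simp
qed

text \<open>The summand is symmetric in \<open>m\<close> and \<open>n\<close>, so that the polynomial of smaller degree can be expanded
  in monomials.\<close>

lemma jacobi_real_orthogonal:
  assumes "0 < q" "q < 1" "0 < a" "a < 1" "b < 1" "m \<noteq> n"
  shows "(\<lambda>k. jacobi_real a b q n (q ^ k) * jacobi_real a b q m (q ^ k)
              * (a ^ k * (qpoch b q k / qpoch q q k))) sums 0"
proof -
  have "(\<lambda>k. jacobi_real a b q n (q ^ k) * jacobi_real a b q m (q ^ k)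
              * (a ^ k * (qpoch b q k / qpoch q q k))) sums 0" if "m < n" for m n
    using jacobi_real_sums[OF assms(1-4), of b n m] that
    by (simp add: jacobi_pairing_lower[OF assms(1-5)])
  from this[of m n] this[of n m] show ?thesis
    using assms(6) by (cases m n rule: linorder_cases) (simp_all only: mult_ac simp_thms)
qed

lemma jacobi_real_norm:
  assumes "0 < q" "q < 1" "0 < a" "a < 1" "b < 1"
  shows "(\<lambda>k. jacobi_real a b q n (q ^ k) * jacobi_real a b q n (q ^ k)
              * (a ^ k * (qpoch b q k / qpoch q q k))) sums
     (jacobi_coeff a b q n n * (\<Sum>j\<le>n. jacobi_coeff a b q n j * jacobi_moment a b q (n + j)))"
proof -
  have "(\<Sum>i\<le>n. jacobi_coeff a b q n i * (\<Sum>j\<le>n. jacobi_coeff a b q n j * jacobi_moment a b q (i + j)))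
     = (\<Sum>i<Suc n. jacobi_coeff a b q n i * (\<Sum>j\<le>n. jacobi_coeff a b q n j * jacobi_moment a b q (i + j)))"
    by (simp only: lessThan_Suc_atMost)
  also have "\<dots> = jacobi_coeff a b q n n * (\<Sum>j\<le>n. jacobi_coeff a b q n j * jacobi_moment a b q (n + j))"
    by (simp add: jacobi_pairing_lower[OF assms])
  finally show ?thesis using jacobi_real_sums[OF assms(1-4), of b n n] by simp
qed

theorem theorem4p6:
  fixes q \<alpha> \<beta> :: real and m n :: nat
  assumes "0 < q" and "q < 1"
    and "0 < \<alpha>" and "\<alpha> < inverse q" and "\<beta> < inverse q"
  shows "summable (little_q_jacobi_term \<alpha> \<beta> q
             (little_q_jacobi n \<alpha> \<beta> q) (little_q_jacobi m \<alpha> \<beta> q)) \<and>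
         little_q_jacobi_inner \<alpha> \<beta> q (little_q_jacobi n \<alpha> \<beta> q) (little_q_jacobi m \<alpha> \<beta> q) =
           (if m = n then of_real (little_q_jacobi_norm n \<alpha> \<beta> q) else 0)"
proof -
  define a b where "a = \<alpha> * q" and "b = \<beta> * q"
  have q: "0 < q" "q < 1" by fact+
  have 1: "\<alpha> * q < 1" "\<beta> * q < 1"
    using assms by (simp_all add: inverse_eq_divide pos_less_divide_eq)
  have ab: "0 < a" "a < 1" "b < 1" using assms 1 by (simp_all add: a_def b_def)
  have t: "little_q_jacobi_term \<alpha> \<beta> q (little_q_jacobi n \<alpha> \<beta> q) (little_q_jacobi m \<alpha> \<beta> q) =
      (\<lambda>k. of_real (jacobi_real a b q n (q ^ k) * jacobi_real a b q m (q ^ k)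
              * (a ^ k * (qpoch b q k / qpoch q q k))))"
    unfolding little_q_jacobi_term_def little_q_jacobi_of_real[OF q(1)] a_def b_def by simp
  have "(\<lambda>k. jacobi_real a b q n (q ^ k) * jacobi_real a b q m (q ^ k)
              * (a ^ k * (qpoch b q k / qpoch q q k))) sums
        (if m = n then little_q_jacobi_norm n \<alpha> \<beta> q else 0)"
    using jacobi_real_orthogonal[OF q ab, of m n] jacobi_real_norm[OF q ab, of n]
      jacobi_norm_eq[OF q assms(3) 1, of n] by (simp add: a_def b_def)
  then have "little_q_jacobi_term \<alpha> \<beta> q (little_q_jacobi n \<alpha> \<beta> q) (little_q_jacobi m \<alpha> \<beta> q) sums
        of_real (if m = n then little_q_jacobi_norm n \<alpha> \<beta> q else 0)"
    unfolding t by (rule sums_of_real)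
  then show ?thesis
    unfolding little_q_jacobi_inner_def by (auto simp: sums_iff)
qed

end
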